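(* Let $s\ge1$ and suppose Assumptions 1, 2 and 3 hold with the same constant $0\le\delta_s<1$. Then there exists a constant $C_U>0$ depending only on $a_u$ and $a_\ell$ such that $$\inf_{\hat f}\ \sup_{f^*\in\mathcal{F}_{T,s,D}}\mathbb{E}\big[\|\hat f-f^*\|_2^2\big]\ \le\ C_U\min\left(\frac{s\log_2 p}{(1-\delta_s)T}+\frac{s\log_2(T+1)}{(1-\delta_s)T},\ s\max_{j,k}|D_{j,k}|^2,\ 1\right),$$ where the infimum is over all measurable estimators $\hat f$ of $f^*$ based on $y$ (which may depend on $T$, $A$, $D$).
   Context: Setup: $n,p\ge1$ integers, $T>0$. $D\in\mathbb{R}^{p\times p}$ is an orthonormal matrix with columns $d_1,\dots,d_p$, where $d_1=p^{-1/2}(1,\dots,1)^\top$; $\bar D=[d_2,\dots,d_p]\in\mathbb{R}^{p\times(p-1)}$. For an integer $s\ge1$, $\mathcal{F}_{T,s,D}=\{f\in\mathbb{R}^p_{\ge0}:\ \|f\|_1=1,\ \|\bar D^\top f\|_0\le s\}$, where $\|v\|_0$ is the number of nonzero entries. Given a sensing matrix $A\in\mathbb{R}^{n\times p}$ and $f^*\in\mathcal{F}_{T,s,D}$, the observation is $y=(y_1,\dots,y_n)$ with independent $y_i\sim\mathrm{Poisson}(T(Af^* )_i)$; expectation is over $y$. Assumption 1: there are constants $a_\ell<a_u$ and a matrix $\widetilde A\in\mathbb{R}^{n\times p}$ with all entries in $[a_\ell/\sqrt n,a_u/\sqrt n]$ such that $A=\big(\widetilde A+\frac{a_u-2a_\ell}{\sqrt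 n}\mathbb{1}_{n\times p}\big)/\big(2(a_u-a_\ell)\sqrt n\big)$, with $\mathbb{1}_{n\times p}$ the all-ones matrix. Assumption 2: there is $\delta_s\ge0$ such that $\|\widetilde A D u\|_2^2\le(1+\delta_s)\|u\|_2^2$ for all $u\in\mathbb{R}^p$ with $\|u\|_0\le 2s$. Assumption 3: with the same $\delta_s$, $\|\widetilde A D u\|_2^2\ge(1-\delta_s)\|u\|_2^2$ for all $u\in\mathbb{R}^p$ with $\|u\|_0\le 2s$. *)

theory Defs
  imports "HOL-Probability.Probability"
begin

text \<open>Vectors in R^m are modelled as nat => real (only indices < m matter);
 matrices as nat => nat => real (row, column).\<close>

definition l0 :: "nat \<Rightarrow> (nat \<Rightarrow> real) \<Rightarrow> nat" where
  "l0 m v = card {j. j < m \<and> v j \<noteq> 0}"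

definition sqnorm :: "nat \<Rightarrow> (nat \<Rightarrow> real) \<Rightarrow> real" where
  "sqnorm m v = (\<Sum>j<m. (v j)^2)"

definition matvec :: "nat \<Rightarrow> (nat \<Rightarrow> nat \<Rightarrow> real) \<Rightarrow> (nat \<Rightarrow> real) \<Rightarrow> nat \<Rightarrow> real" where
  "matvec m M v = (\<lambda>i. \<Sum>j<m. M i j * v j)"

definition orthonormal_mat :: "nat \<Rightarrow> (nat \<Rightarrow> nat \<Rightarrow> real) \<Rightarrow> bool" where
  "orthonormal_mat p D \<longleftrightarrow>
     (\<forall>i<p. \<forall>j<p. (\<Sum>k<p. D k i * D k j) = (if i = j then 1 else 0))"

text \<open>Dbar^T f, indexed by 0..p-2 (column j+1 of D).\<close>
definition DbarT :: "nat \<Rightarrow> (nat \<Rightarrow> nat \<Rightarrow> real) \<Rightarrow> (nat \<Rightarrow> real) \<Rightarrow> nat \<Rightarrow> real" where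
  "DbarT p D f = (\<lambda>j. \<Sum>k<p. D k (Suc j) * f k)"

definition F_class :: "nat \<Rightarrow> nat \<Rightarrow> (nat \<Rightarrow> nat \<Rightarrow> real) \<Rightarrow> (nat \<Rightarrow> real) set" where
  "F_class p s D = {f. (\<forall>k. k \<ge> p \<longrightarrow> f k = 0) \<and> (\<forall>k<p. f k \<ge> 0) \<and>
      (\<Sum>k<p. f k) = 1 \<and> l0 (p - 1) (DbarT p D f) \<le> s}"

definition obs_pmf :: "nat \<Rightarrow> nat \<Rightarrow> real \<Rightarrow> (nat \<Rightarrow> nat \<Rightarrow> real) \<Rightarrow> (nat \<Rightarrow> real) \<Rightarrow> (nat \<Rightarrow> nat) pmf" where
  "obs_pmf n p T A f = Pi_pmf {..<n} 0 (\<lambda>i. poisson_pmf (T * matvec p A f i))"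

definition risk :: "nat \<Rightarrow> nat \<Rightarrow> real \<Rightarrow> (nat \<Rightarrow> nat \<Rightarrow> real) \<Rightarrow>
     ((nat \<Rightarrow> nat) \<Rightarrow> nat \<Rightarrow> real) \<Rightarrow> (nat \<Rightarrow> real) \<Rightarrow> ennreal" where
  "risk n p T A fhat f =
     (\<integral>\<^sup>+ y. ennreal (sqnorm p (\<lambda>k. fhat y k - f k)) \<partial>measure_pmf (obs_pmf n p T A f))"

definition minimax_risk :: "nat \<Rightarrow> nat \<Rightarrow> nat \<Rightarrow> real \<Rightarrow> (nat \<Rightarrow> nat \<Rightarrow> real) \<Rightarrow>
     (nat \<Rightarrow> nat \<Rightarrow> real) \<Rightarrow> ennreal" where
  "minimax_risk n p s T A D =
     (INF fhat. SUP f\<in>F_class p s D. risk n p T A fhat f)"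

end

theory Submission
  imports Defs "Jordan_Normal_Form.Determinant"
begin

text \<open>
  Three estimators give the three terms of the minimum: the zero vector (error at most \<open>1\<close>), the
  uniform vector \<open>1/p\<close> (by Parseval the error is \<open>\<parallel>DbarT f\<parallel>\<^sup>2\<close>, a sum of at most \<open>s\<close> squares), and
  least squares over a finite net \<open>G\<close> of the class. The net contains one representative for every
  value taken by the coefficients \<open>DbarT f\<close> quantised at resolution \<open>1/sqrt T\<close>, so \<open>ln |G|\<close> is of order
  \<open>s ln p + s ln (T + 1)\<close> and every \<open>f\<close> is within squared distance \<open>s/T\<close> of the net.

  All means \<open>(A f)\<^sub>i\<close> lie in \<open>[1/(2n), 1/n]\<close>; hence the noise term of the least squares problem, penalised
  by a quarter of the squared norm, has exponential moment at most \<open>1\<close> at the scale \<open>n T/16\<close>, and a union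
  bound over \<open>G\<close> costs \<open>(ln |G| + 1)/(n T)\<close>. The restricted isometry turns the error of \<open>A f\<close> into the
  error of \<open>f\<close>. For \<open>T < 1\<close> the first term is at least \<open>1\<close>, so this estimator is needed only for \<open>T \<ge> 1\<close>.
\<close>

text \<open>Feeds the bound on the Poisson log-moment. For \<open>x = - t < 0\<close> the claim
  amounts to \<open>1 \<le> (1 - t + t^2) * exp t\<close>; replacing \<open>exp t\<close> by its
  quadratic Taylor polynomial leaves 1 plus positive terms.\<close>

lemma exp_le_quadratic:
  fixes x :: real
  assumes "\<bar>x\<bar> \<le> 1"
  shows "exp x \<le> 1 + x + x\<^sup>2"
proof (cases "x \<ge> 0")
  case True
  then show ?thesis using exp_bound[of x] assms by simp
next
  case False
  define t where "t = - x"
  have t: "t > 0" using False by (simp add: t_def)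
  have "1 - t + t\<^sup>2 = (t - 1 / 2)\<^sup>2 + 3 / 4"
    by (simp add: power2_eq_square algebra_simps)
  moreover have "0 \<le> (t - 1 / 2)\<^sup>2" by simp
  ultimately have pos: "1 - t + t\<^sup>2 > 0" by linarith
  have "1 \<le> (1 - t + t\<^sup>2) * (1 + t + t\<^sup>2 / 2)"
  proof -
    have "(1 - t + t\<^sup>2) * (1 + t + t\<^sup>2 / 2) = 1 + t\<^sup>2 / 2 + t ^ 3 / 2 + t ^ 4 / 2"
      by (simp add: power2_eq_square power3_eq_cube power4_eq_xxxx field_simps)
    then show ?thesis using t by simp
  qed
  also have "\<dots> \<le> (1 - t + t\<^sup>2) * exp t"
    using exp_lower_Taylor_quadratic[of t] t pos by (intro mult_left_mono) auto
  finally have "1 / exp t \<le> 1 - t + t\<^sup>2"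
    by (simp add: field_simps)
  then show ?thesis
    by (simp add: t_def exp_minus field_simps)
qed

subsection \<open>Least squares with Poisson noise\<close>

text \<open>The factor \<open>exp (t * y)\<close> turns the Poisson weights into the exponential
  series at \<open>\<mu> * exp t\<close>. The shift \<open>c\<close> is carried along so that each
  coordinate of a product has exactly this form.\<close>

lemma nn_integral_exp_poisson_pmf:
  assumes "\<mu> > 0"
  shows "(\<integral>\<^sup>+y. ennreal (exp (t * real y - c)) \<partial>measure_pmf (poisson_pmf \<mu>))
    = ennreal (exp (\<mu> * (exp t - 1) - c))"
proof -
  have "(\<integral>\<^sup>+y. ennreal (exp (t * real y - c)) \<partial>measure_pmf (poisson_pmf \<mu>))
      = (\<integral>\<^sup>+y. ennreal (pmf (poisson_pmf \<mu>) y * exp (t * real y - c)) \<partial>count_space UNIV)"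
    by (simp add: nn_integral_measure_pmf ennreal_mult)
  also have "\<dots> = (\<Sum>y. ennreal (pmf (poisson_pmf \<mu>) y * exp (t * real y - c)))"
    by (rule nn_integral_count_space_nat)
  also have "(\<lambda>y. pmf (poisson_pmf \<mu>) y * exp (t * real y - c))
      = (\<lambda>y. exp (- \<mu> - c) * ((\<mu> * exp t) ^ y /\<^sub>R fact y))"
  proof
    fix y
    have "exp (t * real y - c) = exp t ^ y * exp (- c)"
      by (simp add: exp_diff exp_minus field_simps flip: exp_of_nat_mult)
    then show "pmf (poisson_pmf \<mu>) y * exp (t * real y - c)
        = exp (- \<mu> - c) * ((\<mu> * exp t) ^ y /\<^sub>R fact y)"
      using assms by (simp add: power_mult_distrib exp_diff exp_minus field_simps)
  qed
  also have "(\<Sum>y. ennreal (exp (- \<mu> - c) * ((\<mu> * exp t) ^ y /\<^sub>R fact y)))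
      = ennreal (exp (- \<mu> - c) * exp (\<mu> * exp t))"
    using assms
    by (intro suminf_ennreal_eq sums_mult exp_converges mult_nonneg_nonneg) auto
  also have "exp (- \<mu> - c) * exp (\<mu> * exp t) = exp (\<mu> * (exp t - 1) - c)"
    by (simp add: algebra_simps flip: exp_add)
  finally show ?thesis .
qed

text \<open>By independence the moment factors over coordinates. In each, the centred Poisson
  log-moment is at most \<open>T * m i * (t i)^2\<close>, hence at most
  \<open>T * n * (w i)^2 / 64\<close>, which is exactly the quadratic penalty at the scale
  \<open>n * T / 16\<close>.\<close>

lemma poisson_noise_exp_moment_le_1:
  fixes n :: nat and T :: real and m w :: "nat \<Rightarrow> real"
  assumes n: "n > 0" and T: "T > 0"
    and m: "\<And>i. i < n \<Longrightarrow> 0 < m i \<and> m i \<le> 1 / real n"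
    and w: "\<And>i. i < n \<Longrightarrow> \<bar>w i\<bar> \<le> 1 / real n"
  shows "(\<integral>\<^sup>+y. ennreal (exp (real n * T / 16 *
            (\<Sum>i<n. 2 * (real (y i) / T - m i) * w i - (w i)\<^sup>2 / 4)))
          \<partial>measure_pmf (Pi_pmf {..<n} 0 (\<lambda>i. poisson_pmf (T * m i)))) \<le> 1"
proof -
  \<comment> \<open>\<open>t i\<close> is the coefficient of \<open>y i\<close> in the exponent;
    \<open>c i\<close> collects the centring and the penalty.\<close>
  define t c where "t = (\<lambda>i. real n * w i / 8)"
    and "c = (\<lambda>i. T * m i * t i + T * real n * (w i)\<^sup>2 / 64)"
  have "real n * T / 16 * (\<Sum>i<n. 2 * (real (y i) / T - m i) * w i - (w i)\<^sup>2 / 4)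
      = (\<Sum>i<n. t i * real (y i) - c i)" for y :: "nat \<Rightarrow> nat"
    unfolding sum_distrib_left
    using T by (intro sum.cong) (auto simp: t_def c_def field_simps)
  then have "(\<integral>\<^sup>+y. ennreal (exp (real n * T / 16 *
            (\<Sum>i<n. 2 * (real (y i) / T - m i) * w i - (w i)\<^sup>2 / 4)))
          \<partial>measure_pmf (Pi_pmf {..<n} 0 (\<lambda>i. poisson_pmf (T * m i))))
      = (\<integral>\<^sup>+y. (\<Prod>i<n. ennreal (exp (t i * real (y i) - c i)))
          \<partial>measure_pmf (Pi_pmf {..<n} 0 (\<lambda>i. poisson_pmf (T * m i))))"
    by (simp add: exp_sum prod_ennreal)
  also have "\<dots> = (\<Prod>i<n. \<integral>\<^sup>+y. ennreal (exp (t i * real y - c i))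
          \<partial>measure_pmf (poisson_pmf (T * m i)))"
    by (rule nn_integral_prod_Pi_pmf) simp
  also have "\<dots> = (\<Prod>i<n. ennreal (exp (T * m i * (exp (t i) - 1) - c i)))"
    using m T by (intro prod.cong nn_integral_exp_poisson_pmf) auto
  also have "\<dots> = ennreal (\<Prod>i<n. exp (T * m i * (exp (t i) - 1) - c i))"
    by (simp add: prod_ennreal)
  also have "\<dots> \<le> ennreal 1"
  proof (intro ennreal_leI prod_le_1 conjI)
    fix i assume i: "i \<in> {..<n}"
    have "\<bar>t i\<bar> \<le> 1"
      using w[of i] i n by (auto simp: t_def abs_mult field_simps)
    then have "exp (t i) - 1 - t i \<le> (t i)\<^sup>2"
      using exp_le_quadratic[of "t i"] by simp
    then have "T * m i * (exp (t i) - 1 - t i) \<le> T * m i * (t i)\<^sup>2"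
      using m[of i] i T by (intro mult_left_mono) auto
    also have "\<dots> \<le> T * (1 / real n) * (t i)\<^sup>2"
      using m[of i] i T by (intro mult_right_mono mult_left_mono) auto
    also have "\<dots> = T * real n * (w i)\<^sup>2 / 64"
      using n by (simp add: t_def power2_eq_square field_simps)
    finally have "T * m i * (exp (t i) - 1) - c i \<le> 0"
      by (simp add: c_def algebra_simps)
    then show "exp (T * m i * (exp (t i) - 1) - c i) \<le> 1"
      by simp
  qed auto
  finally show ?thesis by simp
qed

text \<open>Here \<open>a\<close> is the fit, \<open>b\<close> a competitor, \<open>m\<close> the
  truth and \<open>z\<close> the data. Expanding the squares gives the usual basic inequality; the
  quarter penalty is inserted by \<open>(a - b)^2 / 4 \<le> (a - m)^2 / 2 + (b - m)^2 / 2\<close>,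
  which costs half of the left side and raises the constant of \<open>b\<close> to 3.\<close>

lemma least_squares_basic_inequality:
  fixes z :: "nat \<Rightarrow> real"
  assumes "sqnorm n (\<lambda>i. z i - a i) \<le> sqnorm n (\<lambda>i. z i - b i)"
  shows "sqnorm n (\<lambda>i. a i - m i) \<le> 3 * sqnorm n (\<lambda>i. b i - m i)
    + 2 * (\<Sum>i<n. 2 * (z i - m i) * (a i - b i) - (a i - b i)\<^sup>2 / 4)"
proof -
  have *: "(a i - m i)\<^sup>2 / 2 + ((z i - b i)\<^sup>2 - (z i - a i)\<^sup>2)
      \<le> 3 / 2 * (b i - m i)\<^sup>2 + (2 * (z i - m i) * (a i - b i) - (a i - b i)\<^sup>2 / 4)" for i
  proof -
    have "3 / 2 * (b i - m i)\<^sup>2 + (2 * (z i - m i) * (a i - b i) - (a i - b i)\<^sup>2 / 4)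
      - ((a i - m i)\<^sup>2 / 2 + ((z i - b i)\<^sup>2 - (z i - a i)\<^sup>2)) = ((a i - m i) + (b i - m i))\<^sup>2 / 4"
      by (simp add: power2_eq_square field_simps)
    moreover have "0 \<le> ((a i - m i) + (b i - m i))\<^sup>2 / 4" by simp
    ultimately show ?thesis by linarith
  qed
  have "sqnorm n (\<lambda>i. a i - m i) / 2 + (sqnorm n (\<lambda>i. z i - b i) - sqnorm n (\<lambda>i. z i - a i))
    \<le> 3 / 2 * sqnorm n (\<lambda>i. b i - m i)
    + (\<Sum>i<n. 2 * (z i - m i) * (a i - b i) - (a i - b i)\<^sup>2 / 4)"
    unfolding sqnorm_def sum_divide_distrib sum_distrib_left
      sum_subtractf[symmetric, of "\<lambda>i. (z i - b i)\<^sup>2"] sum.distrib[symmetric]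
    by (intro sum_mono *)
  with assms show ?thesis by linarith
qed

lemma sqnorm_nonneg: "0 \<le> sqnorm n v"
  by (simp add: sqnorm_def sum_nonneg)

text \<open>An oracle inequality against any \<open>b\<close> in \<open>G\<close>. The minimiser
  depends on the noise, so its noise term is controlled by a sum of exponentials over all of
  \<open>G\<close>, each with expectation at most 1.\<close>

lemma poisson_least_squares_risk:
  fixes n :: nat and T :: real and G :: "'a set" and \<mu> :: "'a \<Rightarrow> nat \<Rightarrow> real"
  defines "fhat \<equiv> \<lambda>y :: nat \<Rightarrow> nat. arg_min_on (\<lambda>g. sqnorm n (\<lambda>i. real (y i) / T - \<mu> g i)) G"
  assumes n: "n > 0" and T: "T > 0" and G: "finite G" and b: "b \<in> G"
    and \<mu>: "\<And>g i. g \<in> G \<Longrightarrow> i < n \<Longrightarrow> 0 \<le> \<mu> g i \<and> \<mu> g i \<le> 1 / real n"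
    and m: "\<And>i. i < n \<Longrightarrow> 0 < m i \<and> m i \<le> 1 / real n"
  shows "(\<integral>\<^sup>+y. ennreal (sqnorm n (\<lambda>i. \<mu> (fhat y) i - m i))
      \<partial>measure_pmf (Pi_pmf {..<n} 0 (\<lambda>i. poisson_pmf (T * m i))))
    \<le> ennreal (3 * sqnorm n (\<lambda>i. \<mu> b i - m i) + 32 / (real n * T) * (ln (card G) + 1))"
proof -
  let ?M = "measure_pmf (Pi_pmf {..<n} 0 (\<lambda>i. poisson_pmf (T * m i)))"
  define X where "X = (\<lambda>g y. \<Sum>i<n. 2 * (real (y i) / T - m i) * (\<mu> g i - \<mu> b i) - (\<mu> g i - \<mu> b i)\<^sup>2 / 4)"
  define \<theta> where "\<theta> = real n * T / 16"
  define N where "N = real (card G)"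
  have \<theta>: "\<theta> > 0" using n T by (simp add: \<theta>_def)
  have "card G > 0" using b G card_gt_0_iff by blast
  then have N: "N \<ge> 1" unfolding N_def by linarith
  have pw: "sqnorm n (\<lambda>i. \<mu> (fhat y) i - m i) \<le> (3 * sqnorm n (\<lambda>i. \<mu> b i - m i) + 2 / \<theta> * ln N)
      + (\<Sum>g\<in>G. 2 / (\<theta> * N) * exp (\<theta> * X g y))" for y
  proof -
    have fG: "fhat y \<in> G"
      unfolding fhat_def using b by (intro arg_min_if_finite(1)[OF G]) auto
    have "sqnorm n (\<lambda>i. real (y i) / T - \<mu> (fhat y) i) \<le> sqnorm n (\<lambda>i. real (y i) / T - \<mu> b i)"
      unfolding fhat_def
      using arg_min_least[OF G _ b, of "\<lambda>g. sqnorm n (\<lambda>i. real (y i) / T - \<mu> g i)"] b by auto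
    then have 1: "sqnorm n (\<lambda>i. \<mu> (fhat y) i - m i) \<le> 3 * sqnorm n (\<lambda>i. \<mu> b i - m i) + 2 * X (fhat y) y"
      unfolding X_def by (rule least_squares_basic_inequality)
    \<comment> \<open>Using \<open>x \<le> exp x\<close> instead of a maximum makes the bound linear
      in the exponentials, ready for integration. Subtracting \<open>ln N\<close> supplies the
      factor \<open>1 / N\<close> that offsets the number of summands.\<close>
    have "\<theta> * X (fhat y) y - ln N \<le> exp (\<theta> * X (fhat y) y - ln N)"
      using exp_ge_add_one_self[of "\<theta> * X (fhat y) y - ln N"] by linarith
    also have "\<dots> = exp (\<theta> * X (fhat y) y) / N"
      using N by (simp add: exp_diff)
    also have "\<dots> \<le> (\<Sum>g\<in>G. exp (\<theta> * X g y)) / N"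
      using N fG G by (intro divide_right_mono member_le_sum) auto
    finally have "X (fhat y) y \<le> ln N / \<theta> + (\<Sum>g\<in>G. exp (\<theta> * X g y)) / (\<theta> * N)"
      using \<theta> N by (simp add: field_simps)
    moreover have "(\<Sum>g\<in>G. 2 / (\<theta> * N) * exp (\<theta> * X g y)) = 2 * ((\<Sum>g\<in>G. exp (\<theta> * X g y)) / (\<theta> * N))"
      unfolding sum_distrib_left[symmetric] by simp
    moreover have "2 / \<theta> * ln N = 2 * (ln N / \<theta>)" by simp
    ultimately show ?thesis using 1 by linarith
  qed
  have "(\<integral>\<^sup>+y. ennreal (sqnorm n (\<lambda>i. \<mu> (fhat y) i - m i)) \<partial>?M)
    \<le> (\<integral>\<^sup>+y. ennreal (3 * sqnorm n (\<lambda>i. \<mu> b i - m i) + 2 / \<theta> * ln N)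
      + (\<Sum>g\<in>G. ennreal (2 / (\<theta> * N)) * ennreal (exp (\<theta> * X g y))) \<partial>?M)"
    using \<theta> N by (intro nn_integral_mono order_trans[OF ennreal_leI[OF pw]])
       (simp add: sum_nonneg sqnorm_nonneg flip: ennreal_mult ennreal_plus)
  also have "\<dots> = ennreal (3 * sqnorm n (\<lambda>i. \<mu> b i - m i) + 2 / \<theta> * ln N)
      + (\<Sum>g\<in>G. ennreal (2 / (\<theta> * N)) * (\<integral>\<^sup>+y. ennreal (exp (\<theta> * X g y)) \<partial>?M))"
    by (subst nn_integral_add) (auto simp: nn_integral_sum nn_integral_cmult)
  also have "\<dots> \<le> ennreal (3 * sqnorm n (\<lambda>i. \<mu> b i - m i) + 2 / \<theta> * ln N)
      + (\<Sum>g\<in>G. ennreal (2 / (\<theta> * N)) * 1)"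
  proof (intro add_left_mono sum_mono mult_left_mono)
    fix g assume g: "g \<in> G"
    \<comment> \<open>Both means lie in \<open>[0, 1/n]\<close>, so their difference is an
      admissible weight \<open>w\<close> for the moment bound.\<close>
    have "\<bar>\<mu> g i - \<mu> b i\<bar> \<le> 1 / real n" if "i < n" for i
      using \<mu>[OF g that] \<mu>[OF b that] by (auto simp: abs_le_iff)
    then show "(\<integral>\<^sup>+y. ennreal (exp (\<theta> * X g y)) \<partial>?M) \<le> 1"
      unfolding \<theta>_def X_def using m by (intro poisson_noise_exp_moment_le_1 n T) auto
  qed auto
  also have "\<dots> = ennreal (3 * sqnorm n (\<lambda>i. \<mu> b i - m i) + 2 / \<theta> * ln N) + ennreal (2 / \<theta>)"
    using \<theta> N by (simp add: N_def ennreal_of_nat_eq_real_of_nat flip: ennreal_mult)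
  also have "\<dots> = ennreal (3 * sqnorm n (\<lambda>i. \<mu> b i - m i) + 2 / \<theta> * ln N + 2 / \<theta>)"
    using \<theta> N by (subst ennreal_plus) (auto intro!: add_nonneg_nonneg simp: sqnorm_nonneg)
  also have "3 * sqnorm n (\<lambda>i. \<mu> b i - m i) + 2 / \<theta> * ln N + 2 / \<theta>
      = 3 * sqnorm n (\<lambda>i. \<mu> b i - m i) + 32 / (real n * T) * (ln (card G) + 1)"
    by (simp add: \<theta>_def N_def add_divide_distrib distrib_left)
  finally show ?thesis .
qed

subsection \<open>Parseval identity for orthonormal matrices\<close>

text \<open>Orthonormal columns say that the transpose is a left inverse; for a square matrix it is
  then also a right inverse.\<close>

lemma orthonormal_mat_rows:
  assumes "orthonormal_mat p D" "i < p" "j < p"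
  shows "(\<Sum>k<p. D i k * D j k) = (if i = j then 1 else 0)"
proof -
  define M where "M = mat p p (\<lambda>(i, j). D i j)"
  have M: "M \<in> carrier_mat p p" "transpose_mat M \<in> carrier_mat p p" by (auto simp: M_def)
  have "transpose_mat M * M = 1\<^sub>m p"
    using assms(1)
    by (intro eq_matI) (auto simp: M_def scalar_prod_def orthonormal_mat_def lessThan_atLeast0)
  then have "M * transpose_mat M = 1\<^sub>m p"
    using mat_mult_left_right_inverse[OF M(2,1)] by simp
  then have "(M * transpose_mat M) $$ (i, j) = 1\<^sub>m p $$ (i, j)" by simp
  then show ?thesis
    using assms(2,3) by (simp add: M_def scalar_prod_def lessThan_atLeast0)
qed

lemma orthonormal_mat_synthesis:
  assumes "orthonormal_mat p D" "i < p"
  shows "matvec p D (\<lambda>j. \<Sum>k<p. D k j * h k) i = h i"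
proof -
  have "matvec p D (\<lambda>j. \<Sum>k<p. D k j * h k) i = (\<Sum>k<p. (\<Sum>j<p. D i j * D k j) * h k)"
    unfolding matvec_def sum_distrib_left sum_distrib_right
    by (subst sum.swap) (simp add: mult.assoc)
  also have "\<dots> = (\<Sum>k<p. (if i = k then 1 else 0) * h k)"
    using assms by (intro sum.cong) (auto simp: orthonormal_mat_rows)
  also have "\<dots> = h i"
    using assms(2) by (simp add: if_distrib[of "\<lambda>c. c * _"] cong: if_cong)
  finally show ?thesis .
qed

text \<open>Moving one factor of \<open>D\<close> across the inner product leaves the synthesis of
  the coefficients of \<open>h\<close>, which is \<open>h\<close> again.\<close>

lemma orthonormal_mat_parseval:
  assumes "orthonormal_mat p D"
  shows "sqnorm p (\<lambda>j. \<Sum>k<p. D k j * h k) = sqnorm p h"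
proof -
  let ?c = "\<lambda>j. \<Sum>k<p. D k j * h k"
  have "sqnorm p ?c = (\<Sum>j<p. \<Sum>k<p. h k * (D k j * ?c j))"
    by (simp add: sqnorm_def power2_eq_square sum_distrib_left sum_distrib_right mult_ac)
  also have "\<dots> = (\<Sum>k<p. h k * matvec p D ?c k)"
    unfolding matvec_def sum_distrib_left by (rule sum.swap)
  also have "\<dots> = sqnorm p h"
    using orthonormal_mat_synthesis[OF assms] by (simp add: sqnorm_def power2_eq_square)
  finally show ?thesis .
qed

subsection \<open>Quantising sparse vectors\<close>

text \<open>Serves twice: for the quantisation error, and for the error of the uniform
  estimator.\<close>

lemma sqnorm_sparse_le:
  assumes l0: "l0 m v \<le> s" and B: "\<And>j. j < m \<Longrightarrow> (v j)\<^sup>2 \<le> B" and "0 \<le> B"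
  shows "sqnorm m v \<le> real s * B"
proof -
  have "sqnorm m v = (\<Sum>j | j < m \<and> v j \<noteq> 0. (v j)\<^sup>2)"
    unfolding sqnorm_def by (rule sum.mono_neutral_right) auto
  also have "\<dots> \<le> real (card {j. j < m \<and> v j \<noteq> 0}) * B"
    using B by (intro sum_bounded_above) auto
  also have "\<dots> \<le> real s * B"
    using l0 \<open>0 \<le> B\<close> by (intro mult_right_mono) (auto simp: l0_def)
  finally show ?thesis .
qed

text \<open>Induction on \<open>s\<close>: a function with at most \<open>s + 1\<close> nonzero
  entries arises from one with at most \<open>s\<close> by a single update, for which there are
  \<open>p\<close> positions and \<open>2 * K + 1\<close> values.\<close>

lemma card_sparse_int_functions:
  fixes p K s :: nat
  assumes "p > 0"
  defines "L \<equiv> \<lambda>s. {q :: nat \<Rightarrow> int. (\<forall>j. q j \<noteq> 0 \<longrightarrow> j < p \<and> \<bar>q j\<bar> \<le> int K) \<and> card {j. q j \<noteq> 0} \<le> s}"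
  shows "finite (L s)" and "card (L s) \<le> (p * (2 * K + 1)) ^ s"
proof -
  have "finite (L s) \<and> card (L s) \<le> (p * (2 * K + 1)) ^ s"
  proof (induction s)
    case 0
    \<comment> \<open>\<open>card\<close> is 0 on infinite sets too, so the support must be known to
      be finite before cardinality 0 makes it empty.\<close>
    have "finite {j. q j \<noteq> 0}" if "\<forall>j. q j \<noteq> 0 \<longrightarrow> j < p \<and> P j" for q :: "nat \<Rightarrow> int" and P
      by (rule finite_subset[of _ "{..<p}"]) (use that in auto)
    then have "L 0 \<subseteq> {\<lambda>_. 0}"
      by (auto simp: L_def fun_eq_iff)
    then show ?case
      using card_mono[of "{\<lambda>_. 0}" "L 0"] finite_subset by fastforce
  next
    case (Suc s)
    let ?U = "\<lambda>(q :: nat \<Rightarrow> int, j, k). q(j := k)"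
    let ?P = "L s \<times> {..<p} \<times> {- int K..int K}"
    have "L (Suc s) \<subseteq> ?U ` ?P"
    proof
      fix q assume q: "q \<in> L (Suc s)"
      have fin: "finite {j. q j \<noteq> 0}"
        by (rule finite_subset[of _ "{..<p}"]) (use q in \<open>auto simp: L_def\<close>)
      show "q \<in> ?U ` ?P"
      proof (cases "\<exists>j. q j \<noteq> 0")
        case False
        \<comment> \<open>The zero function has no entry to erase; writing 0 at position 0, which
          exists since \<open>p > 0\<close>, reproduces it.\<close>
        then have "q = ?U (q, 0, 0)" "(q, 0, 0) \<in> ?P"
          using assms by (auto simp: L_def)
        then show ?thesis by (rule image_eqI)
      next
        case True
        then obtain j where j: "q j \<noteq> 0" by blast
        have eq: "{i. (q(j := 0)) i \<noteq> 0} = {i. q i \<noteq> 0} - {j}" by auto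
        have "card {i. (q(j := 0)) i \<noteq> 0} \<le> s"
          unfolding eq using q j fin by (subst card_Diff_singleton) (auto simp: L_def)
        then have "q(j := 0) \<in> L s"
          using q by (auto simp: L_def)
        then have "q = ?U (q(j := 0), j, q j)" "(q(j := 0), j, q j) \<in> ?P"
          using q j by (auto simp: L_def)
        then show ?thesis by (rule image_eqI)
      qed
    qed
    moreover have "finite ?P" using Suc by simp
    moreover have "nat (2 * int K + 1) = 2 * K + 1" by linarith
    then have "card ?P = card (L s) * (p * (2 * K + 1))"
      by (simp add: card_cartesian_product)
    moreover have "card (?U ` ?P) \<le> card ?P"
      using Suc by (intro card_image_le) simp
    ultimately have "finite (L (Suc s))" "card (L (Suc s)) \<le> card (L s) * (p * (2 * K + 1))"
      using finite_subset[of "L (Suc s)" "?U ` ?P"] card_mono[of "?U ` ?P" "L (Suc s)"] by auto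
    moreover have "card (L s) * (p * (2 * K + 1)) \<le> (p * (2 * K + 1)) ^ Suc s"
      using Suc by (simp only: power_Suc2 mult_le_mono)
    ultimately show ?case by linarith
  qed
  then show "finite (L s)" "card (L s) \<le> (p * (2 * K + 1)) ^ s" by auto
qed

text \<open>Rounding away from zero keeps the support of a vector visible in its quantisation.\<close>

definition round_away :: "real \<Rightarrow> int" where
  "round_away x = (if x \<ge> 0 then \<lceil>x\<rceil> else \<lfloor>x\<rfloor>)"

lemma round_away_eq_0_iff [simp]: "round_away x = 0 \<longleftrightarrow> x = 0"
  unfolding round_away_def by (auto simp: floor_eq_iff ceiling_eq_iff)

lemma round_away_eqD: "round_away x = round_away y \<Longrightarrow> \<bar>x - y\<bar> \<le> 1"
  unfolding round_away_def by (auto split: if_splits; linarith)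

lemma abs_round_away_le: "\<bar>x\<bar> \<le> real K \<Longrightarrow> \<bar>round_away x\<bar> \<le> int K"
  unfolding round_away_def by (auto split: if_splits; linarith)

text \<open>Entries from \<open>m\<close> on are set to 0, so that labels agreeing below
  \<open>m\<close> are equal as functions and have finite support.\<close>

definition quantise :: "nat \<Rightarrow> real \<Rightarrow> (nat \<Rightarrow> real) \<Rightarrow> nat \<Rightarrow> int" where
  "quantise m r v = (\<lambda>j. if j < m then round_away (v j * r) else 0)"

text \<open>Equal labels force equal supports, so the difference has at most \<open>s\<close>
  nonzero entries, each of size at most \<open>1 / r\<close>.\<close>

lemma quantise_eq_imp_sqnorm_le:
  assumes "quantise m r v = quantise m r w" "r > 0" "l0 m v \<le> s"
  shows "sqnorm m (\<lambda>j. v j - w j) \<le> real s * (1 / r\<^sup>2)"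
proof (rule sqnorm_sparse_le)
  have eq: "round_away (v j * r) = round_away (w j * r)" if "j < m" for j
    using fun_cong[OF assms(1), of j] that by (simp add: quantise_def)
  have "w j = 0" if "j < m" "v j = 0" for j
    using eq[OF that(1)] that(2) \<open>r > 0\<close> by (metis mult_eq_0_iff round_away_eq_0_iff less_irrefl)
  then have "{j. j < m \<and> v j - w j \<noteq> 0} \<subseteq> {j. j < m \<and> v j \<noteq> 0}" by auto
  then have "l0 m (\<lambda>j. v j - w j) \<le> l0 m v"
    unfolding l0_def by (intro card_mono) auto
  then show "l0 m (\<lambda>j. v j - w j) \<le> s" using assms(3) by simp
  show "(v j - w j)\<^sup>2 \<le> 1 / r\<^sup>2" if "j < m" for j
  proof -
    have "\<bar>(v j - w j) * r\<bar> \<le> 1"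
      using round_away_eqD[OF eq[OF that]] by (simp add: left_diff_distrib)
    then have "((v j - w j) * r)\<^sup>2 \<le> 1"
      by (simp add: abs_square_le_1)
    then show ?thesis
      using \<open>r > 0\<close> unfolding power_mult_distrib by (simp add: pos_le_divide_eq)
  qed
qed simp

text \<open>The quantised entries are integers in \<open>[-K, K]\<close>, so the counting lemma
  applies. Counting positions among \<open>p > m\<close> covers \<open>m = 0\<close> as
  well.\<close>

lemma quantise_image:
  assumes V: "\<And>v. v \<in> V \<Longrightarrow> l0 m v \<le> s \<and> (\<forall>j<m. \<bar>v j\<bar> \<le> 1)" and r: "0 \<le> r" "r \<le> real K" and m: "m < p"
  shows "finite (quantise m r ` V)" "card (quantise m r ` V) \<le> (p * (2 * K + 1)) ^ s"
proof -
  let ?L = "{q :: nat \<Rightarrow> int. (\<forall>j. q j \<noteq> 0 \<longrightarrow> j < p \<and> \<bar>q j\<bar> \<le> int K) \<and> card {j. q j \<noteq> 0} \<le> s}"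
  have sub: "quantise m r ` V \<subseteq> ?L"
  proof safe
    fix v j assume v: "v \<in> V"
    have "{j. quantise m r v j \<noteq> 0} \<subseteq> {j. j < m \<and> v j \<noteq> 0}"
      by (auto simp: quantise_def split: if_splits)
    then have "card {j. quantise m r v j \<noteq> 0} \<le> l0 m v"
      unfolding l0_def by (intro card_mono) auto
    then show "card {j. quantise m r v j \<noteq> 0} \<le> s" using V[OF v] by simp
    assume j: "quantise m r v j \<noteq> 0"
    then have jm: "j < m" by (simp add: quantise_def split: if_splits)
    then show "j < p" using m by simp
    have "\<bar>v j * r\<bar> \<le> 1 * r"
      unfolding abs_mult using V[OF v] jm r by (intro mult_mono) auto
    then have "\<bar>v j * r\<bar> \<le> real K" using r by simp
    then show "\<bar>quantise m r v j\<bar> \<le> int K"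
      using jm by (simp add: quantise_def abs_round_away_le)
  qed
  note L = card_sparse_int_functions[where p = p and K = K and s = s]
  show "finite (quantise m r ` V)"
    using finite_subset[OF sub] L(1) m by simp
  show "card (quantise m r ` V) \<le> (p * (2 * K + 1)) ^ s"
    using m by (intro order_trans[OF card_mono[OF L(1) sub] L(2)]) auto
qed

subsection \<open>The signal class\<close>

lemma sum_le_1_imp_sqnorm_le_1:
  assumes "\<And>k. k < p \<Longrightarrow> 0 \<le> f k" "(\<Sum>k<p. f k) = 1"
  shows "sqnorm p f \<le> 1"
proof -
  have "sqnorm p f \<le> (\<Sum>k<p. f k)"
    unfolding sqnorm_def
  proof (rule sum_mono)
    fix k assume k: "k \<in> {..<p}"
    have "f k \<le> 1"
      using member_le_sum[of k "{..<p}" f] k assms by auto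
    then show "(f k)\<^sup>2 \<le> f k"
      using assms(1)[of k] k mult_left_mono[of "f k" 1 "f k"] by (auto simp: power2_eq_square)
  qed
  with assms(2) show ?thesis by simp
qed

context
  fixes p s :: nat and D :: "nat \<Rightarrow> nat \<Rightarrow> real"
  assumes p: "p \<ge> 1" and orth: "orthonormal_mat p D"
    and D0: "\<forall>k<p. D k 0 = 1 / sqrt (real p)"
begin

text \<open>The first column is constant and both vectors have mass 1. Hence a difference of class
  members is determined by its \<open>DbarT\<close> coefficients.\<close>

lemma F_class_coefficient_0:
  assumes "f \<in> F_class p s D" "g \<in> F_class p s D"
  shows "(\<Sum>k<p. D k 0 * (f k - g k)) = 0"
proof -
  have "(\<Sum>k<p. D k 0 * (f k - g k)) = (\<Sum>k<p. 1 / sqrt (real p) * (f k - g k))"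
    using D0 by (intro sum.cong) auto
  also have "\<dots> = 1 / sqrt (real p) * ((\<Sum>k<p. f k) - (\<Sum>k<p. g k))"
    by (simp only: sum_subtractf flip: sum_distrib_left)
  also have "\<dots> = 0"
    using assms by (simp add: F_class_def)
  finally show ?thesis .
qed

lemma DbarT_diff: "DbarT p D f j - DbarT p D g j = (\<Sum>k<p. D k (Suc j) * (f k - g k))"
  by (simp add: DbarT_def right_diff_distrib sum_subtractf)

lemma F_class_sqnorm_diff:
  assumes "f \<in> F_class p s D" "g \<in> F_class p s D"
  shows "sqnorm p (\<lambda>k. f k - g k) = sqnorm (p - 1) (\<lambda>j. DbarT p D f j - DbarT p D g j)"
proof -
  obtain q where q: "p = Suc q" using p by (cases p) auto
  have "sqnorm p (\<lambda>k. f k - g k) = sqnorm p (\<lambda>j. \<Sum>k<p. D k j * (f k - g k))"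
    by (rule orthonormal_mat_parseval[OF orth, symmetric])
  also have "\<dots> = (\<Sum>k<p. D k 0 * (f k - g k))\<^sup>2 + (\<Sum>j<p - 1. (\<Sum>k<p. D k (Suc j) * (f k - g k))\<^sup>2)"
    \<comment> \<open>Splitting off column 0 shifts indices: column \<open>j + 1\<close> of
      \<open>D\<close> is entry \<open>j\<close> of \<open>DbarT\<close>.\<close>
    unfolding sqnorm_def by (subst q, subst sum.lessThan_Suc_shift) (simp add: q)
  also have "\<dots> = sqnorm (p - 1) (\<lambda>j. DbarT p D f j - DbarT p D g j)"
    by (simp add: F_class_coefficient_0[OF assms] DbarT_diff sqnorm_def)
  finally show ?thesis .
qed

lemma F_class_sqnorm_le_1: "f \<in> F_class p s D \<Longrightarrow> sqnorm p f \<le> 1"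
  by (rule sum_le_1_imp_sqnorm_le_1) (auto simp: F_class_def)

text \<open>As \<open>f\<close> is a probability vector, each coefficient is an average of the
  entries of one column.\<close>

lemma F_class_coefficient_le:
  assumes "f \<in> F_class p s D" "\<And>j k. j < p \<Longrightarrow> k < p \<Longrightarrow> \<bar>D j k\<bar> \<le> B" "j < p - 1"
  shows "\<bar>DbarT p D f j\<bar> \<le> B"
proof -
  have "\<bar>DbarT p D f j\<bar> \<le> (\<Sum>k<p. B * f k)"
    unfolding DbarT_def using assms
    by (intro order_trans[OF sum_abs] sum_mono) (auto simp: abs_mult F_class_def intro!: mult_right_mono)
  also have "\<dots> = B" using assms(1) by (simp add: F_class_def flip: sum_distrib_left)
  finally show ?thesis .
qed

lemma orthonormal_mat_entry_le_1:
  assumes "j < p" "k < p"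
  shows "\<bar>D j k\<bar> \<le> 1"
proof -
  have "(D j k)\<^sup>2 \<le> (\<Sum>i<p. (D i k)\<^sup>2)"
    using assms by (intro member_le_sum) auto
  also have "\<dots> = 1"
    using orth assms by (simp add: orthonormal_mat_def power2_eq_square)
  finally show ?thesis by (simp add: abs_square_le_1)
qed

text \<open>The uniform vector is a multiple of the first column and so orthogonal to all
  others.\<close>

lemma uniform_in_F_class:
  defines "g \<equiv> \<lambda>k. if k < p then 1 / real p else 0"
  shows "g \<in> F_class p s D" and "j < p - 1 \<Longrightarrow> DbarT p D g j = 0"
proof -
  show z: "DbarT p D g j = 0" if "j < p - 1" for j
  proof -
    have "(\<Sum>k<p. D k (Suc j) * D k 0) = 0"
      using orth that by (simp add: orthonormal_mat_def)
    then have "0 = (\<Sum>k<p. D k (Suc j) * D k 0) / sqrt (real p)" by simp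
    also have "\<dots> = (\<Sum>k<p. D k (Suc j) * (1 / real p))"
      unfolding sum_divide_distrib using D0 by (intro sum.cong) auto
    also have "\<dots> = DbarT p D g j"
      by (simp add: DbarT_def g_def)
    finally show ?thesis by simp
  qed
  have "l0 (p - 1) (DbarT p D g) = 0"
    using z by (simp add: l0_def)
  then show "g \<in> F_class p s D"
    using p by (simp add: F_class_def g_def)
qed

text \<open>The coefficient vector \<open>u\<close> of \<open>f - g\<close> has no entry at 0 and is
  otherwise supported in the union of two \<open>s\<close>-sparse supports, while
  \<open>D u = f - g\<close>. The abstract relation \<open>P\<close> lets one proof serve the upper
  and the lower isometry bound.\<close>

lemma F_class_restricted_isometry:
  assumes f: "f \<in> F_class p s D" and g: "g \<in> F_class p s D"
    and P: "\<And>u. (\<forall>k. k \<ge> p \<longrightarrow> u k = 0) \<Longrightarrow> l0 p u \<le> 2 * s \<Longrightarrow>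
      P (sqnorm n (matvec p At (matvec p D u))) (sqnorm p u)"
  shows "P (sqnorm n (matvec p At (\<lambda>k. f k - g k))) (sqnorm p (\<lambda>k. f k - g k))"
proof -
  define c where "c = (\<lambda>j. \<Sum>k<p. D k j * (f k - g k))"
  define u where "u = (\<lambda>j. if j < p then c j else 0)"
  have "{j. j < p \<and> u j \<noteq> 0} \<subseteq> Suc ` ({j. j < p - 1 \<and> DbarT p D f j \<noteq> 0} \<union> {j. j < p - 1 \<and> DbarT p D g j \<noteq> 0})"
  proof
    fix j assume j: "j \<in> {j. j < p \<and> u j \<noteq> 0}"
    then obtain i where i: "j = Suc i"
      using F_class_coefficient_0[OF f g] by (cases j) (auto simp: u_def c_def)
    then show "j \<in> Suc ` ({j. j < p - 1 \<and> DbarT p D f j \<noteq> 0} \<union> {j. j < p - 1 \<and> DbarT p D g j \<noteq> 0})"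
      using j DbarT_diff[of f i g] by (auto simp: u_def c_def)
  qed
  then have "l0 p u \<le> card (Suc ` ({j. j < p - 1 \<and> DbarT p D f j \<noteq> 0} \<union> {j. j < p - 1 \<and> DbarT p D g j \<noteq> 0}))"
    unfolding l0_def by (intro card_mono) auto
  also have "\<dots> \<le> l0 (p - 1) (DbarT p D f) + l0 (p - 1) (DbarT p D g)"
    unfolding l0_def by (subst card_image) (auto intro: card_Un_le)
  also have "\<dots> \<le> 2 * s"
    using f g by (simp add: F_class_def)
  finally have "P (sqnorm n (matvec p At (matvec p D u))) (sqnorm p u)"
    by (intro P) (auto simp: u_def)
  moreover have "sqnorm p u = sqnorm p (\<lambda>k. f k - g k)"
    using orthonormal_mat_parseval[OF orth, of "\<lambda>k. f k - g k"]
    by (simp add: u_def c_def sqnorm_def)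
  moreover have "matvec p D u k = f k - g k" if "k < p" for k
    using orthonormal_mat_synthesis[OF orth that, of "\<lambda>k. f k - g k"]
    by (simp add: u_def c_def matvec_def)
  then have "matvec p At (matvec p D u) = matvec p At (\<lambda>k. f k - g k)"
    unfolding matvec_def[of p At] by (intro ext sum.cong) auto
  ultimately show ?thesis by simp
qed

section \<open>Estimators that ignore the data\<close>

lemma minimax_risk_le_const:
  assumes "\<And>f. f \<in> F_class p s D \<Longrightarrow> sqnorm p (\<lambda>k. g k - f k) \<le> B"
  shows "minimax_risk n p s T A D \<le> ennreal B"
proof -
  have "minimax_risk n p s T A D \<le> (SUP f\<in>F_class p s D. risk n p T A (\<lambda>_. g) f)"
    unfolding minimax_risk_def by (rule INF_lower) simp
  also have "\<dots> \<le> ennreal B"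
    using assms by (intro SUP_least) (simp add: risk_def ennreal_leI)
  finally show ?thesis .
qed

lemma minimax_risk_le_1: "minimax_risk n p s T A D \<le> ennreal 1"
  using F_class_sqnorm_le_1
  by (intro minimax_risk_le_const[where g = "\<lambda>_. 0"]) (simp add: sqnorm_def)

lemma minimax_risk_le_sparsity:
  "minimax_risk n p s T A D \<le> ennreal (real s * Max {\<bar>D j k\<bar>\<^sup>2 | j k. j < p \<and> k < p})"
proof (rule minimax_risk_le_const)
  fix f assume f: "f \<in> F_class p s D"
  define M where "M = Max {\<bar>D j k\<bar>\<^sup>2 | j k. j < p \<and> k < p}"
  let ?g = "\<lambda>k. if k < p then 1 / real p else 0"
  have eq: "{\<bar>D j k\<bar>\<^sup>2 | j k. j < p \<and> k < p} = (\<lambda>(j, k). \<bar>D j k\<bar>\<^sup>2) ` ({..<p} \<times> {..<p})"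
    by auto
  have M: "\<bar>D j k\<bar>\<^sup>2 \<le> M" if "j < p" "k < p" for j k
    unfolding M_def eq using that by (intro Max_ge) auto
  have M0: "0 \<le> M" using M[of 0 0] p zero_le_power2[of "\<bar>D 0 0\<bar>"] by linarith
  have "sqnorm p (\<lambda>k. ?g k - f k) = sqnorm p (\<lambda>k. f k - ?g k)"
    by (simp add: sqnorm_def power2_commute)
  also have "\<dots> = sqnorm (p - 1) (DbarT p D f)"
    using F_class_sqnorm_diff[OF f uniform_in_F_class(1)] uniform_in_F_class(2)
    by (simp add: sqnorm_def)
  also have "\<dots> \<le> real s * M"
  proof (rule sqnorm_sparse_le)
    show "l0 (p - 1) (DbarT p D f) \<le> s" using f by (simp add: F_class_def)
    show "(DbarT p D f j)\<^sup>2 \<le> M" if "j < p - 1" for j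
    proof -
      have "\<bar>DbarT p D f j\<bar> \<le> sqrt M"
        using M by (intro F_class_coefficient_le[OF f _ that] real_le_rsqrt) auto
      then have "\<bar>DbarT p D f j\<bar>\<^sup>2 \<le> (sqrt M)\<^sup>2" by (intro power_mono) auto
      with M0 show ?thesis by simp
    qed
  qed fact
  finally show "sqnorm p (\<lambda>k. ?g k - f k) \<le> real s * M" .
qed

end

subsection \<open>The minimax bound\<close>

lemma matvec_diff: "matvec p M (\<lambda>k. f k - g k) i = matvec p M f i - matvec p M g i"
  by (simp add: matvec_def right_diff_distrib sum_subtractf)

lemma ln_le_log2: "1 \<le> x \<Longrightarrow> ln x \<le> log 2 x"
  using ln_le_minus_one[of 2] ln_gt_zero[of "2::real"] ln_ge_zero[of x]
  by (simp add: log_def field_simps mult_left_le)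

lemma log2_Suc_ge_1: "T \<ge> 1 \<Longrightarrow> 1 \<le> log 2 (T + 1)"
  by (simp add: le_log_iff)

text \<open>For \<open>T \<ge> 1\<close> the factor
  \<open>2 * nat \<lceil>sqrt T\<rceil> + 1\<close> is at most \<open>2 * T + 3\<close>, hence at
  most \<open>(T + 1)^4\<close>. This gives the coefficient 4; the additive 1 is absorbed by one
  more \<open>s * log 2 (T + 1)\<close>.\<close>

lemma ln_net_size_le:
  fixes T :: real and p s :: nat
  assumes "T \<ge> 1" "p \<ge> 1" "s \<ge> 1" "N \<ge> 1" "N \<le> (p * (2 * nat \<lceil>sqrt T\<rceil> + 1)) ^ s"
  shows "ln (real N) + 1 \<le> 5 * (real s * log 2 (real p) + real s * log 2 (T + 1))"
proof -
  let ?K = "nat \<lceil>sqrt T\<rceil>"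
  have "real ?K \<le> sqrt T + 1"
    using of_int_ceiling_le_add_one[of "sqrt T"] assms(1) by simp
  moreover have "sqrt T \<le> T"
    using assms(1) by (intro real_le_lsqrt) (auto simp: power2_eq_square)
  moreover have "1 \<le> T ^ 4" "T \<le> T ^ 4" using assms(1) power_increasing[of 1 4 T] by auto
  moreover have "(T + 1) ^ 4 = T ^ 4 + 4 * T ^ 3 + 6 * T\<^sup>2 + 4 * T + 1"
    by (simp add: power4_eq_xxxx power3_eq_cube power2_eq_square algebra_simps)
  moreover have "0 \<le> T ^ 3" "0 \<le> T\<^sup>2" using assms(1) by auto
  ultimately have "2 * real ?K + 1 \<le> (T + 1) ^ 4" using assms(1) by linarith
  then have "ln (2 * real ?K + 1) \<le> ln ((T + 1) ^ 4)"
    by (subst ln_le_cancel_iff) (auto intro: less_le_trans[of _ 1] add_pos_nonneg)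
  also have "\<dots> = 4 * ln (T + 1)"
    using assms(1) by (simp add: ln_realpow)
  also have "\<dots> \<le> 4 * log 2 (T + 1)"
    using ln_le_log2[of "T + 1"] assms(1) by simp
  finally have K: "ln (2 * real ?K + 1) \<le> 4 * log 2 (T + 1)" .
  have "ln (real N) \<le> ln (real ((p * (2 * ?K + 1)) ^ s))"
    using assms by (intro ln_mono) (auto simp del: of_nat_power)
  also have "real ((p * (2 * ?K + 1)) ^ s) = (real p * (2 * real ?K + 1)) ^ s"
    by (simp add: algebra_simps)
  also have "ln \<dots> = real s * (ln (real p) + ln (2 * real ?K + 1))"
    using assms(2) by (simp add: ln_realpow ln_mult add_pos_nonneg)
  also have "\<dots> \<le> real s * (log 2 (real p) + 4 * log 2 (T + 1))"
    using K ln_le_log2[of "real p"] assms(2) by (intro mult_left_mono add_mono) auto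
  finally have "ln (real N) + 1 \<le> real s * (log 2 (real p) + 4 * log 2 (T + 1)) + real s * log 2 (T + 1)"
    using log2_Suc_ge_1[OF assms(1)] assms(3) mult_mono[of 1 "real s" 1 "log 2 (T + 1)"] by simp
  moreover have "0 \<le> real s * log 2 (real p)" using assms by simp
  ultimately show ?thesis by (simp add: algebra_simps)
qed

lemma minimax_risk_le_estimation:
  fixes a_l a_u T \<delta> :: real and n p s :: nat
  assumes a: "a_l < a_u" and n: "n \<ge> 1" and p: "p \<ge> 1" and s: "s \<ge> 1" and T: "T \<ge> 1"
    and orth: "orthonormal_mat p D" and D0: "\<forall>k<p. D k 0 = 1 / sqrt (real p)"
    and At: "\<forall>i<n. \<forall>j<p. a_l / sqrt (real n) \<le> At i j \<and> At i j \<le> a_u / sqrt (real n)"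
    and A: "\<forall>i j. A i j = (At i j + (a_u - 2 * a_l) / sqrt (real n)) / (2 * (a_u - a_l) * sqrt (real n))"
    and \<delta>: "0 \<le> \<delta>" "\<delta> < 1"
    and upper: "\<And>u. (\<forall>k. k \<ge> p \<longrightarrow> u k = 0) \<Longrightarrow> l0 p u \<le> 2 * s \<Longrightarrow>
        sqnorm n (matvec p At (matvec p D u)) \<le> (1 + \<delta>) * sqnorm p u"
    and lower: "\<And>u. (\<forall>k. k \<ge> p \<longrightarrow> u k = 0) \<Longrightarrow> l0 p u \<le> 2 * s \<Longrightarrow>
        sqnorm n (matvec p At (matvec p D u)) \<ge> (1 - \<delta>) * sqnorm p u"
  shows "minimax_risk n p s T A D \<le> ennreal ((6 + 640 * (a_u - a_l)\<^sup>2) *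
    (real s * log 2 (real p) / ((1 - \<delta>) * T) + real s * log 2 (T + 1) / ((1 - \<delta>) * T)))"
proof -
  let ?F = "F_class p s D"
  \<comment> \<open>\<open>\<kappa> * n\<close> is the square of the denominator
    \<open>2 * (a_u - a_l) * sqrt n\<close> in the definition of \<open>A\<close>.\<close>
  define \<kappa> where "\<kappa> = 4 * (a_u - a_l)\<^sup>2"
  define K where "K = nat \<lceil>sqrt T\<rceil>"
  define \<mu> where "\<mu> = matvec p A"
  \<comment> \<open>Resolution \<open>1 / sqrt T\<close> makes the quantisation error
    \<open>s / T\<close>, no larger in order than the stochastic error.\<close>
  define label where "label = (\<lambda>f. quantise (p - 1) (sqrt T) (DbarT p D f))"
  \<comment> \<open>Choosing representatives inside the class keeps every estimate in the class, so
    the isometry bounds apply to the estimation error.\<close>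
  define G where "G = inv_into ?F label ` (label ` ?F)"
  define fhat where "fhat = (\<lambda>y :: nat \<Rightarrow> nat. arg_min_on (\<lambda>g. sqnorm n (\<lambda>i. real (y i) / T - \<mu> g i)) G)"
  define R where "R = real s * log 2 (real p) + real s * log 2 (T + 1)"
  have \<kappa>: "\<kappa> > 0" using a by (simp add: \<kappa>_def)

  have A_entry: "1 / (2 * real n) \<le> A i j \<and> A i j \<le> 1 / real n" if "i < n" "j < p" for i j
  proof -
    \<comment> \<open>The shift carries the range of \<open>At\<close> to an interval whose right
      end is twice the left end, both proportional to \<open>a_u - a_l\<close>; the denominator then
      cancels that factor.\<close>
    have num: "(a_u - a_l) / sqrt n \<le> At i j + (a_u - 2 * a_l) / sqrt n"
      "At i j + (a_u - 2 * a_l) / sqrt n \<le> 2 * (a_u - a_l) / sqrt n"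
      using At[rule_format, OF that] unfolding diff_divide_distrib left_diff_distrib right_diff_distrib
      by linarith+
    have "x / r / (2 * x * r) = 1 / (2 * (r * r))" "2 * x / r / (2 * x * r) = 1 / (r * r)"
      if "x > 0" "r > 0" for x r :: real
      using that by (simp_all add: field_simps)
    from this[of "a_u - a_l" "sqrt n"]
    have "(a_u - a_l) / sqrt n / (2 * (a_u - a_l) * sqrt n) = 1 / (2 * real n)"
      "2 * (a_u - a_l) / sqrt n / (2 * (a_u - a_l) * sqrt n) = 1 / real n"
      using a n by simp_all
    moreover have "0 \<le> 2 * (a_u - a_l) * sqrt n" using a by simp
    ultimately show ?thesis
      using divide_right_mono[OF num(1)] divide_right_mono[OF num(2)] A by metis
  qed
  have \<mu>_bounds: "1 / (2 * real n) \<le> \<mu> f i \<and> \<mu> f i \<le> 1 / real n" if f: "f \<in> ?F" and i: "i < n" for f i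
  proof -
    have f': "\<And>k. k < p \<Longrightarrow> 0 \<le> f k" "(\<Sum>k<p. f k) = 1"
      using f by (auto simp: F_class_def)
    have "(\<Sum>k<p. 1 / (2 * real n) * f k) \<le> \<mu> f i" "\<mu> f i \<le> (\<Sum>k<p. 1 / real n * f k)"
      unfolding \<mu>_def matvec_def using A_entry[OF i] f'(1)
      by (intro sum_mono mult_right_mono; simp)+
    then show ?thesis by (simp only: f'(2) mult_1_right flip: sum_distrib_left)
  qed
  have \<mu>_diff: "sqnorm n (\<lambda>i. \<mu> f i - \<mu> g i) = sqnorm n (matvec p At (\<lambda>k. f k - g k)) / (\<kappa> * real n)"
    if f: "f \<in> ?F" and g: "g \<in> ?F" for f g
  proof -
    define b where "b = (a_u - 2 * a_l) / sqrt n"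
    define c where "c = 2 * (a_u - a_l) * sqrt n"
    have c2: "c\<^sup>2 = \<kappa> * real n" unfolding c_def \<kappa>_def power_mult_distrib by simp
    \<comment> \<open>Equal masses annihilate the constant shift in \<open>A\<close>, so only
      \<open>At\<close> acts on the difference.\<close>
    have "(\<Sum>k<p. f k - g k) = 0"
      using f g by (simp add: F_class_def sum_subtractf)
    have "\<mu> f i - \<mu> g i = matvec p At (\<lambda>k. f k - g k) i / c" for i
    proof -
      have "\<mu> f i - \<mu> g i = (\<Sum>k<p. (At i k + b) / c * (f k - g k))"
        unfolding \<mu>_def matvec_diff[symmetric] by (simp add: matvec_def A b_def c_def)
      also have "\<dots> = (\<Sum>k<p. At i k * (f k - g k) / c + b / c * (f k - g k))"
        by (intro sum.cong) (auto simp: add_divide_distrib algebra_simps)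
      also have "\<dots> = matvec p At (\<lambda>k. f k - g k) i / c + b / c * (\<Sum>k<p. f k - g k)"
        by (simp only: matvec_def sum.distrib sum_divide_distrib sum_distrib_left)
      finally show ?thesis using \<open>(\<Sum>k<p. f k - g k) = 0\<close> by simp
    qed
    then show ?thesis
      by (simp add: sqnorm_def power_divide c2 flip: sum_divide_distrib)
  qed
  have \<mu>_upper: "sqnorm n (\<lambda>i. \<mu> f i - \<mu> g i) \<le> 2 * sqnorm p (\<lambda>k. f k - g k) / (\<kappa> * real n)"
    if f: "f \<in> ?F" and g: "g \<in> ?F" for f g
  proof -
    have "sqnorm n (matvec p At (\<lambda>k. f k - g k)) \<le> (1 + \<delta>) * sqnorm p (\<lambda>k. f k - g k)"
      by (rule F_class_restricted_isometry[OF p orth D0 f g, where P = "\<lambda>x y. x \<le> (1 + \<delta>) * y"])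
        (rule upper)
    also have "\<dots> \<le> 2 * sqnorm p (\<lambda>k. f k - g k)"
      using \<delta> by (intro mult_right_mono) (auto simp: sqnorm_nonneg)
    finally show ?thesis
      using \<mu>_diff[OF f g] \<kappa> by (simp add: divide_right_mono)
  qed
  have \<mu>_lower: "sqnorm p (\<lambda>k. f k - g k) \<le> \<kappa> * real n / (1 - \<delta>) * sqnorm n (\<lambda>i. \<mu> f i - \<mu> g i)"
    if f: "f \<in> ?F" and g: "g \<in> ?F" for f g
  proof -
    have "(1 - \<delta>) * sqnorm p (\<lambda>k. f k - g k) \<le> sqnorm n (matvec p At (\<lambda>k. f k - g k))"
      by (rule F_class_restricted_isometry[OF p orth D0 f g, where P = "\<lambda>x y. (1 - \<delta>) * y \<le> x"])
        (rule lower)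
    then show ?thesis
      using \<mu>_diff[OF f g] \<kappa> n \<delta> by (simp add: field_simps)
  qed

  have coeffs: "l0 (p - 1) v \<le> s \<and> (\<forall>j<p - 1. \<bar>v j\<bar> \<le> 1)" if "v \<in> DbarT p D ` ?F" for v
  proof -
    from that obtain f where f: "f \<in> ?F" "v = DbarT p D f" by blast
    then have "l0 (p - 1) v \<le> s" by (simp add: F_class_def)
    moreover have "\<bar>v j\<bar> \<le> 1" if "j < p - 1" for j
      unfolding f(2)
      by (rule F_class_coefficient_le[OF p orth D0 f(1) _ that])
        (rule orthonormal_mat_entry_le_1[OF p orth D0])
    ultimately show ?thesis by blast
  qed
  have "0 \<le> sqrt T" "sqrt T \<le> real K" "p - 1 < p"
    using T p real_nat_ceiling_ge[of "sqrt T"] by (auto simp: K_def)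
  from quantise_image[where V = "DbarT p D ` ?F", OF coeffs this]
  have labels: "finite (label ` ?F)" "card (label ` ?F) \<le> (p * (2 * K + 1)) ^ s"
    by (simp_all add: image_image label_def)
  have finG: "finite G" and GF: "G \<subseteq> ?F" and cardG: "card G \<le> (p * (2 * K + 1)) ^ s"
    using labels card_image_le[OF labels(1)] by (auto simp: G_def inv_into_into intro: le_trans)

  have risk: "risk n p T A fhat f \<le> ennreal ((6 + 640 * (a_u - a_l)\<^sup>2) * (R / ((1 - \<delta>) * T)))"
    if f: "f \<in> ?F" for f
  proof -
    \<comment> \<open>The net point with the same label as \<open>f\<close> is the competitor in the
      oracle inequality.\<close>
    define b where "b = inv_into ?F label (label f)"
    have bG: "b \<in> G" using f by (auto simp: b_def G_def)
    then have bF: "b \<in> ?F" using GF by auto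
    have "label b = label f"
      unfolding b_def using f by (rule f_inv_into_f[OF imageI])
    then have "sqnorm (p - 1) (\<lambda>j. DbarT p D b j - DbarT p D f j) \<le> real s * (1 / (sqrt T)\<^sup>2)"
      unfolding label_def using T bF
      by (intro quantise_eq_imp_sqnorm_le) (auto simp: F_class_def)
    then have "sqnorm p (\<lambda>k. b k - f k) \<le> real s / T"
      using T F_class_sqnorm_diff[OF p orth D0 bF f] by simp
    then have approx: "sqnorm n (\<lambda>i. \<mu> b i - \<mu> f i) \<le> 2 * (real s / T) / (\<kappa> * real n)"
      using \<kappa> by (intro order_trans[OF \<mu>_upper[OF bF f]] divide_right_mono mult_left_mono) auto
    have card1: "card G \<ge> 1" using bG finG by (metis card_0_eq empty_iff less_one not_le)
    have fhatF: "fhat y \<in> ?F" for y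
      unfolding fhat_def using bG GF arg_min_if_finite(1)[OF finG] by blast
    have "risk n p T A fhat f \<le> (\<integral>\<^sup>+y. ennreal (\<kappa> * real n / (1 - \<delta>)) *
        ennreal (sqnorm n (\<lambda>i. \<mu> (fhat y) i - \<mu> f i)) \<partial>measure_pmf (obs_pmf n p T A f))"
      unfolding risk_def using \<mu>_lower[OF fhatF f] \<kappa> \<delta>
      by (intro nn_integral_mono) (simp add: sqnorm_nonneg ennreal_leI flip: ennreal_mult)
    also have "\<dots> = ennreal (\<kappa> * real n / (1 - \<delta>)) * (\<integral>\<^sup>+y.
        ennreal (sqnorm n (\<lambda>i. \<mu> (fhat y) i - \<mu> f i)) \<partial>measure_pmf (obs_pmf n p T A f))"
      by (rule nn_integral_cmult) simp
    also have "\<dots> \<le> ennreal (\<kappa> * real n / (1 - \<delta>)) *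
        ennreal (3 * sqnorm n (\<lambda>i. \<mu> b i - \<mu> f i) + 32 / (real n * T) * (ln (card G) + 1))"
    proof (rule mult_left_mono)
      have pos: "0 < \<mu> g i \<and> 0 \<le> \<mu> g i \<and> \<mu> g i \<le> 1 / real n" if "g \<in> ?F" "i < n" for g i
      proof -
        have "0 < 1 / (2 * real n)" using n by simp
        with \<mu>_bounds[OF that] show ?thesis by linarith
      qed
      show "(\<integral>\<^sup>+y. ennreal (sqnorm n (\<lambda>i. \<mu> (fhat y) i - \<mu> f i)) \<partial>measure_pmf (obs_pmf n p T A f))
        \<le> ennreal (3 * sqnorm n (\<lambda>i. \<mu> b i - \<mu> f i) + 32 / (real n * T) * (ln (card G) + 1))"
        unfolding fhat_def obs_pmf_def \<mu>_def[symmetric]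
        using pos GF f n T finG bG by (intro poisson_least_squares_risk) auto
    qed simp
    also have "\<dots> = ennreal (\<kappa> * real n / (1 - \<delta>) *
        (3 * sqnorm n (\<lambda>i. \<mu> b i - \<mu> f i) + 32 / (real n * T) * (ln (card G) + 1)))"
      using \<kappa> \<delta> by (subst ennreal_mult') auto
    also have "\<dots> \<le> ennreal ((6 + 640 * (a_u - a_l)\<^sup>2) * (R / ((1 - \<delta>) * T)))"
    proof (rule ennreal_leI)
      have "real s * 1 \<le> real s * log 2 (T + 1)"
        using log2_Suc_ge_1[OF T] by (intro mult_left_mono) auto
      moreover have "0 \<le> real s * log 2 (real p)" using p by simp
      ultimately have sR: "real s \<le> R" unfolding R_def by linarith
      have lnR: "ln (card G) + 1 \<le> 5 * R"
        unfolding R_def using T p s card1 cardG by (intro ln_net_size_le) (auto simp: K_def)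
      have "\<kappa> * real n / (1 - \<delta>) *
          (3 * sqnorm n (\<lambda>i. \<mu> b i - \<mu> f i) + 32 / (real n * T) * (ln (card G) + 1))
        \<le> \<kappa> * real n / (1 - \<delta>) *
          (3 * (2 * (R / T) / (\<kappa> * real n)) + 32 / (real n * T) * (5 * R))"
      proof (intro mult_left_mono add_mono lnR)
        have "2 * (real s / T) / (\<kappa> * real n) \<le> 2 * (R / T) / (\<kappa> * real n)"
          using sR T \<kappa> by (intro divide_right_mono mult_left_mono) auto
        with approx show "sqnorm n (\<lambda>i. \<mu> b i - \<mu> f i) \<le> 2 * (R / T) / (\<kappa> * real n)" by linarith
      qed (use T \<kappa> \<delta> in auto)
      \<comment> \<open>The 6 comes from the approximation error, \<open>3 * 2\<close>, and 160 from
        the noise, \<open>32 * 5\<close>; \<open>160 * \<kappa>\<close> is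
        \<open>640 * (a_u - a_l)^2\<close>.\<close>
      also have "\<dots> = (6 + 160 * \<kappa>) * (R / ((1 - \<delta>) * T))"
        using T \<kappa> \<delta> n by (simp add: field_simps)
      finally show "\<kappa> * real n / (1 - \<delta>) *
          (3 * sqnorm n (\<lambda>i. \<mu> b i - \<mu> f i) + 32 / (real n * T) * (ln (card G) + 1))
        \<le> (6 + 640 * (a_u - a_l)\<^sup>2) * (R / ((1 - \<delta>) * T))"
        by (simp add: \<kappa>_def)
    qed
    finally show ?thesis .
  qed
  have "minimax_risk n p s T A D \<le> (SUP f\<in>?F. risk n p T A fhat f)"
    unfolding minimax_risk_def by (rule INF_lower) simp
  also have "\<dots> \<le> ennreal ((6 + 640 * (a_u - a_l)\<^sup>2) * (R / ((1 - \<delta>) * T)))"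
    by (intro SUP_least risk)
  finally show ?thesis by (simp add: R_def add_divide_distrib)
qed

text \<open>By convexity, \<open>2 powr T\<close> lies below its chord \<open>T + 1\<close> on
  \<open>[0, 1]\<close>.\<close>

lemma log2_Suc_ge_self:
  fixes T :: real
  assumes "0 \<le> T" "T \<le> 1"
  shows "T \<le> log 2 (T + 1)"
proof -
  have "2 powr T = exp ((1 - T) *\<^sub>R 0 + T *\<^sub>R ln 2)" by (simp add: powr_def)
  also have "\<dots> \<le> (1 - T) * exp 0 + T * exp (ln 2)"
    using assms by (intro convex_onD[OF exp_convex]) auto
  also have "\<dots> = T + 1" by simp
  finally show ?thesis using assms by (simp add: le_log_iff)
qed

theorem theorem2:
  fixes a_l a_u :: real
  assumes "a_l < a_u"
  shows "\<exists>C_U > 0. \<forall>(n::nat) (p::nat) (s::nat) (T::real) (D::nat \<Rightarrow> nat \<Rightarrow> real)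
      (At::nat \<Rightarrow> nat \<Rightarrow> real) (A::nat \<Rightarrow> nat \<Rightarrow> real) (\<delta>::real).
    n \<ge> 1 \<longrightarrow> p \<ge> 1 \<longrightarrow> s \<ge> 1 \<longrightarrow> T > 0 \<longrightarrow>
    orthonormal_mat p D \<longrightarrow> (\<forall>k<p. D k 0 = 1 / sqrt (real p)) \<longrightarrow>
    (\<forall>i<n. \<forall>j<p. a_l / sqrt (real n) \<le> At i j \<and> At i j \<le> a_u / sqrt (real n)) \<longrightarrow>
    (\<forall>i j. A i j = (At i j + (a_u - 2 * a_l) / sqrt (real n)) / (2 * (a_u - a_l) * sqrt (real n))) \<longrightarrow>
    0 \<le> \<delta> \<longrightarrow> \<delta> < 1 \<longrightarrow>
    (\<forall>u. (\<forall>k. k \<ge> p \<longrightarrow> u k = 0) \<longrightarrow> l0 p u \<le> 2 * s \<longrightarrow>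
        sqnorm n (matvec p At (matvec p D u)) \<le> (1 + \<delta>) * sqnorm p u) \<longrightarrow>
    (\<forall>u. (\<forall>k. k \<ge> p \<longrightarrow> u k = 0) \<longrightarrow> l0 p u \<le> 2 * s \<longrightarrow>
        sqnorm n (matvec p At (matvec p D u)) \<ge> (1 - \<delta>) * sqnorm p u) \<longrightarrow>
    minimax_risk n p s T A D \<le>
      ennreal (C_U * min (real s * log 2 (real p) / ((1 - \<delta>) * T)
                          + real s * log 2 (T + 1) / ((1 - \<delta>) * T))
                    (min (real s * Max {\<bar>D j k\<bar>^2 | j k. j < p \<and> k < p}) 1))"
proof (intro exI[of _ "6 + 640 * (a_u - a_l)\<^sup>2"] conjI allI impI)
  show "0 < 6 + 640 * (a_u - a_l)\<^sup>2" by (simp add: add_pos_nonneg)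
next
  fix n p s :: nat and T \<delta> :: real and D At A :: "nat \<Rightarrow> nat \<Rightarrow> real"
  assume n: "n \<ge> 1" and p: "p \<ge> 1" and s: "s \<ge> 1" and T: "T > 0"
    and orth: "orthonormal_mat p D" and D0: "\<forall>k<p. D k 0 = 1 / sqrt (real p)"
    and At: "\<forall>i<n. \<forall>j<p. a_l / sqrt (real n) \<le> At i j \<and> At i j \<le> a_u / sqrt (real n)"
    and A: "\<forall>i j. A i j = (At i j + (a_u - 2 * a_l) / sqrt (real n)) / (2 * (a_u - a_l) * sqrt (real n))"
    and \<delta>: "0 \<le> \<delta>" "\<delta> < 1"
    and upper: "\<forall>u. (\<forall>k. k \<ge> p \<longrightarrow> u k = 0) \<longrightarrow> l0 p u \<le> 2 * s \<longrightarrow>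
        sqnorm n (matvec p At (matvec p D u)) \<le> (1 + \<delta>) * sqnorm p u"
    and lower: "\<forall>u. (\<forall>k. k \<ge> p \<longrightarrow> u k = 0) \<longrightarrow> l0 p u \<le> 2 * s \<longrightarrow>
        sqnorm n (matvec p At (matvec p D u)) \<ge> (1 - \<delta>) * sqnorm p u"
  define C where "C = 6 + 640 * (a_u - a_l)\<^sup>2"
  define E where "E = real s * log 2 (real p) / ((1 - \<delta>) * T) + real s * log 2 (T + 1) / ((1 - \<delta>) * T)"
  define S where "S = real s * Max {\<bar>D j k\<bar>^2 | j k. j < p \<and> k < p}"
  let ?r = "minimax_risk n p s T A D"
  have C: "C \<ge> 1" by (simp add: C_def)
  have le1: "?r \<le> ennreal (min S 1)"
    using minimax_risk_le_1[OF p orth D0] minimax_risk_le_sparsity[OF p orth D0]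
    by (auto simp: S_def min_def)
  have le2: "?r \<le> ennreal (C * min S 1)"
  proof (cases "min S 1 \<ge> 0")
    case True
    then show ?thesis
      using C mult_right_mono[of 1 C "min S 1"] by (intro order_trans[OF le1] ennreal_leI) simp
  next
    \<comment> \<open>\<open>ennreal\<close> sends a negative number to 0, so \<open>le1\<close>
      already forces the risk to be 0.\<close>
    case False
    then have "ennreal (min S 1) = 0" by (intro ennreal_neg) simp
    then show ?thesis using le1 by simp
  qed
  show "?r \<le> ennreal ((6 + 640 * (a_u - a_l)\<^sup>2) * min (real s * log 2 (real p) / ((1 - \<delta>) * T)
                          + real s * log 2 (T + 1) / ((1 - \<delta>) * T))
                    (min (real s * Max {\<bar>D j k\<bar>^2 | j k. j < p \<and> k < p}) 1))"
    unfolding E_def[symmetric] C_def[symmetric] S_def[symmetric]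
  proof (cases "T \<ge> 1")
    case True
    have "?r \<le> ennreal (C * E)"
      unfolding C_def E_def using upper lower
      by (intro minimax_risk_le_estimation[OF assms n p s True orth D0 At A \<delta>]) blast+
    then show "?r \<le> ennreal (C * min E (min S 1))"
      using le2 by (auto simp: min_def)
  next
    case False
    \<comment> \<open>Below \<open>T = 1\<close> the second summand of \<open>E\<close> alone is at
      least 1, so \<open>E\<close> does not affect the minimum.\<close>
    have "(1 - \<delta>) * T \<le> 1 * T" using \<delta> T by (intro mult_right_mono) auto
    also have "1 * T \<le> 1 * log 2 (T + 1)" using log2_Suc_ge_self[of T] T False by simp
    also have "\<dots> \<le> real s * log 2 (T + 1)" using s T by (intro mult_right_mono) auto
    finally have "1 \<le> real s * log 2 (T + 1) / ((1 - \<delta>) * T)"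
      using \<delta> T by (simp add: field_simps)
    moreover have "0 \<le> real s * log 2 (real p) / ((1 - \<delta>) * T)"
      using p \<delta> T by (intro divide_nonneg_nonneg mult_nonneg_nonneg) auto
    ultimately have "1 \<le> E" unfolding E_def by linarith
    then have "min E (min S 1) = min S 1" by auto
    with le2 show "?r \<le> ennreal (C * min E (min S 1))" by simp
  qed
qed

end
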